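(* Let $p:\mathbb{R}^n\to\mathbb{R}$ be a cubic polynomial that has a second-order point. Then the optimal value of the semidefinite program $$\begin{aligned} \sup_{\gamma\in\mathbb{R},\,\sigma(x),\,S(x)}\quad & \gamma\\ \text{subject to}\quad & p(x)-\gamma=\sigma(x)+\mathrm{Tr}(S(x)\nabla^2 p(x)),\\ & \sigma(x)\ \text{is a degree-2 sos polynomial},\\ & S(x)\ \text{is an } n\times n \text{ sos-matrix with degree-2 entries} \end{aligned}$$ is attained and is equal to the value of $p$ at all second-order points of $p$.
   Context: A cubic (resp. degree-2) polynomial is a real polynomial all of whose monomials have degree at most 3 (resp. at most 2). A second-order point of $p$ is a point $x$ with $\nabla p(x)=0$ and $\nabla^2 p(x)\succeq 0$ (positive semidefinite). $\mathrm{Tr}$ is the trace. A polynomial is sos (a sum of squares) if it equals $\sum_{i=1}^r q_i^2$ for some polynomials $q_i$. A symmetric $m\times m$ matrix $M(x)$ with polynomial entries is an sos-matrix if $M(x)=R(x)^TR(x)$ for some $r\times m$ polynomial matrix $R(x)$. In the program, $x$ is not a decision variable: the decision variables are $\gamma$, the coefficients of $\sigma$, and the coefficients of the entries of $S$, and the first constraint is an identity of polynomials in $x\in\mathbb{R}^n$. *)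

theory Defs
  imports "HOL-Analysis.Analysis"
begin

text \<open>
  Polynomials in \<open>n\<close> real variables are represented by the functions they induce on \<open>real ^ 'n\<close>.
  As \<open>\<real>\<close> is infinite, a polynomial is determined by its function, so an identity of polynomials
  is the same as equality at every point. Where no degree bound is required, the notion
  is \<^const>\<open>real_polynomial_function\<close>.
\<close>

definition monomial_fun :: "('n::finite \<Rightarrow> nat) \<Rightarrow> real ^ 'n \<Rightarrow> real" where
  "monomial_fun a x = (\<Prod>i\<in>UNIV. (x $ i) ^ a i)"

text \<open>The index set of the sum is finite because \<open>'n\<close> is.\<close>

definition polynomial_of_degree_le :: "nat \<Rightarrow> (real ^ 'n::finite \<Rightarrow> real) \<Rightarrow> bool" where
  "polynomial_of_degree_le d f \<longleftrightarrow>
     (\<exists>c :: ('n \<Rightarrow> nat) \<Rightarrow> real.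
        \<forall>x. f x = (\<Sum>a \<in> {a. (\<Sum>i\<in>UNIV. a i) \<le> d}. c a * monomial_fun a x))"

definition partial_derivative ::
    "'n::finite \<Rightarrow> (real ^ 'n \<Rightarrow> real) \<Rightarrow> real ^ 'n \<Rightarrow> real" where
  "partial_derivative i f x = deriv (\<lambda>t. f (x + t *\<^sub>R axis i 1)) 0"

definition hessian :: "(real ^ 'n::finite \<Rightarrow> real) \<Rightarrow> real ^ 'n \<Rightarrow> real ^ 'n ^ 'n" where
  "hessian f x = (\<chi> i j. partial_derivative i (partial_derivative j f) x)"

definition positive_semidefinite :: "real ^ 'n::finite ^ 'n \<Rightarrow> bool" where
  "positive_semidefinite A \<longleftrightarrow> transpose A = A \<and> (\<forall>v. v \<bullet> (A *v v) \<ge> 0)"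

definition second_order_point :: "(real ^ 'n::finite \<Rightarrow> real) \<Rightarrow> real ^ 'n \<Rightarrow> bool" where
  "second_order_point p x \<longleftrightarrow> GDERIV p x :> 0 \<and> positive_semidefinite (hessian p x)"

definition sos :: "(real ^ 'n::finite \<Rightarrow> real) \<Rightarrow> bool" where
  "sos f \<longleftrightarrow>
     (\<exists>(r::nat) q. (\<forall>k<r. real_polynomial_function (q k)) \<and> (\<forall>x. f x = (\<Sum>k<r. (q k x)\<^sup>2)))"

text \<open>
  The number \<open>r\<close> of rows of the factor is existentially quantified, so the \<open>r \<times> m\<close> polynomial
  matrix \<open>R\<close> is indexed by a natural number \<open>k < r\<close> and by \<open>'m\<close>; the sum is the
  \<open>(i, j)\<close> entry of \<open>R(x)\<^sup>T R(x)\<close>.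
\<close>

definition sos_matrix :: "(real ^ 'n::finite \<Rightarrow> real ^ 'm::finite ^ 'm) \<Rightarrow> bool" where
  "sos_matrix M \<longleftrightarrow>
     (\<forall>i j. real_polynomial_function (\<lambda>x. M x $ i $ j)) \<and>
     (\<forall>x. transpose (M x) = M x) \<and>
     (\<exists>(r::nat) (R :: nat \<Rightarrow> 'm \<Rightarrow> real ^ 'n \<Rightarrow> real).
        (\<forall>k<r. \<forall>i. real_polynomial_function (R k i)) \<and>
        (\<forall>x i j. M x $ i $ j = (\<Sum>k<r. R k i x * R k j x)))"

definition sdp_feasible ::
    "(real ^ 'n::finite \<Rightarrow> real) \<Rightarrow>
       (real \<times> (real ^ 'n \<Rightarrow> real) \<times> (real ^ 'n \<Rightarrow> real ^ 'n ^ 'n)) set" where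
  "sdp_feasible p = {(\<gamma>, \<sigma>, S).
     (\<forall>x. p x - \<gamma> = \<sigma> x + trace (S x ** hessian p x)) \<and>
     polynomial_of_degree_le 2 \<sigma> \<and> sos \<sigma> \<and>
     sos_matrix S \<and> (\<forall>i j. polynomial_of_degree_le 2 (\<lambda>x. S x $ i $ j))}"

text \<open>Extended reals, so that infeasible and unbounded programs have a value as well.\<close>

definition sdp_value :: "(real ^ 'n::finite \<Rightarrow> real) \<Rightarrow> ereal" where
  "sdp_value p = (SUP (\<gamma>, \<sigma>, S) \<in> sdp_feasible p. ereal \<gamma>)"

end

(*
  Along the line from a second-order point x to y, p restricts to a univariate cubic g with
  g'(0) = 0, for which g(1) - g(0) = g''(0)/3 + g''(1)/6. With v = y - x this reads
  p(y) - p(x) = v^T H(x) v / 3 + Tr((v v^T / 6) H(y)), where H is the Hessian: a feasible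
  point with value p(x), as H(x) is psd and hence v^T H(x) v is a sum of squares of linear
  forms. Conversely, evaluating the constraint of any feasible point at a second-order point x
  gives p(x) - gamma >= 0, because the trace of a product of two psd matrices is nonnegative.
*)

theory Submission
  imports Defs
begin

section \<open>Polynomials of bounded degree\<close>

text \<open>Each exponent is at most the total degree, so the set lies in a finite box. Since a sum
  over an infinite set is 0 by convention, this is what makes the sums in
  \<open>polynomial_of_degree_le\<close> genuine.\<close>

lemma finite_multidegree_le: "finite {a :: 'n::finite \<Rightarrow> nat. (\<Sum>i\<in>UNIV. a i) \<le> d}"
proof (rule finite_subset)
  show "{a :: 'n \<Rightarrow> nat. (\<Sum>i\<in>UNIV. a i) \<le> d} \<subseteq> PiE UNIV (\<lambda>_. {..d})"
  proof
    fix a :: "'n \<Rightarrow> nat"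
    assume "a \<in> {a. (\<Sum>i\<in>UNIV. a i) \<le> d}"
    then have "a i \<le> d" for i
      using member_le_sum [of i UNIV a] by simp
    then show "a \<in> PiE UNIV (\<lambda>_. {..d})"
      by (simp add: PiE_UNIV_domain)
  qed
qed (simp add: finite_PiE)

lemma polynomial_of_degree_le_monomial:
  fixes a :: "'n::finite \<Rightarrow> nat"
  assumes "(\<Sum>i\<in>UNIV. a i) \<le> d"
  shows "polynomial_of_degree_le d (monomial_fun a)"
  unfolding polynomial_of_degree_le_def
proof (intro exI allI)
  fix x :: "real ^ 'n"
  show "monomial_fun a x =
      (\<Sum>b \<in> {b. (\<Sum>i\<in>UNIV. b i) \<le> d}. (if b = a then 1 else 0) * monomial_fun b x)"
    using assms
    by (simp add: if_distrib [of "\<lambda>c. c * _"] sum.delta finite_multidegree_le cong: if_cong)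
qed

lemma polynomial_of_degree_le_cmult:
  assumes "polynomial_of_degree_le d f"
  shows "polynomial_of_degree_le d (\<lambda>x. k * f x)"
proof -
  obtain c where "\<And>x. f x = (\<Sum>a \<in> {a. (\<Sum>i\<in>UNIV. a i) \<le> d}. c a * monomial_fun a x)"
    using assms unfolding polynomial_of_degree_le_def by blast
  then show ?thesis
    unfolding polynomial_of_degree_le_def
    by (intro exI [of _ "\<lambda>a. k * c a"]) (simp add: sum_distrib_left mult.assoc)
qed

lemma polynomial_of_degree_le_add:
  assumes "polynomial_of_degree_le d f" "polynomial_of_degree_le d g"
  shows "polynomial_of_degree_le d (\<lambda>x. f x + g x)"
proof -
  obtain c where "\<And>x. f x = (\<Sum>a \<in> {a. (\<Sum>i\<in>UNIV. a i) \<le> d}. c a * monomial_fun a x)"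
    using assms(1) unfolding polynomial_of_degree_le_def by blast
  moreover
  obtain c' where "\<And>x. g x = (\<Sum>a \<in> {a. (\<Sum>i\<in>UNIV. a i) \<le> d}. c' a * monomial_fun a x)"
    using assms(2) unfolding polynomial_of_degree_le_def by blast
  ultimately show ?thesis
    unfolding polynomial_of_degree_le_def
    by (intro exI [of _ "\<lambda>a. c a + c' a"]) (simp add: sum.distrib distrib_right)
qed

lemma polynomial_of_degree_le_0: "polynomial_of_degree_le d (\<lambda>x. 0)"
  unfolding polynomial_of_degree_le_def by (intro exI [of _ "\<lambda>_. 0"]) simp

lemma polynomial_of_degree_le_sum:
  assumes "\<And>i. i \<in> I \<Longrightarrow> polynomial_of_degree_le d (f i)"
  shows "polynomial_of_degree_le d (\<lambda>x. \<Sum>i\<in>I. f i x)"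
  using assms
  by (induction I rule: infinite_finite_induct)
     (simp_all add: polynomial_of_degree_le_0 polynomial_of_degree_le_add)

lemma polynomial_of_degree_le_mult:
  assumes "polynomial_of_degree_le d f" "polynomial_of_degree_le e g"
  shows "polynomial_of_degree_le (d + e) (\<lambda>x. f x * g x)"
proof -
  obtain c where c: "\<And>x. f x = (\<Sum>a \<in> {a. (\<Sum>i\<in>UNIV. a i) \<le> d}. c a * monomial_fun a x)"
    using assms(1) unfolding polynomial_of_degree_le_def by blast
  obtain c' where c': "\<And>x. g x = (\<Sum>b \<in> {b. (\<Sum>i\<in>UNIV. b i) \<le> e}. c' b * monomial_fun b x)"
    using assms(2) unfolding polynomial_of_degree_le_def by blast
  \<comment> \<open>Equal exponents are not collected in the expanded product; closure under sums
    and scalar multiples handles it term by term.\<close>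
  have "f x * g x = (\<Sum>a \<in> {a. (\<Sum>i\<in>UNIV. a i) \<le> d}. \<Sum>b \<in> {b. (\<Sum>i\<in>UNIV. b i) \<le> e}.
      (c a * c' b) * monomial_fun (\<lambda>i. a i + b i) x)" for x
    unfolding c c' sum_product
    by (simp add: monomial_fun_def power_add prod.distrib mult_ac)
  moreover have "polynomial_of_degree_le (d + e)
      (\<lambda>x. \<Sum>a \<in> {a. (\<Sum>i\<in>UNIV. a i) \<le> d}. \<Sum>b \<in> {b. (\<Sum>i\<in>UNIV. b i) \<le> e}.
        (c a * c' b) * monomial_fun (\<lambda>i. a i + b i) x)"
    by (intro polynomial_of_degree_le_sum polynomial_of_degree_le_cmult
          polynomial_of_degree_le_monomial)
       (simp add: sum.distrib add_mono)
  ultimately show ?thesis by simp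
qed

lemma polynomial_of_degree_le_const: "polynomial_of_degree_le d (\<lambda>x. k)"
  using polynomial_of_degree_le_cmult [OF polynomial_of_degree_le_monomial [of "\<lambda>_. 0" d], of k]
  by (simp add: monomial_fun_def [abs_def])

lemma monomial_fun_unit: "monomial_fun (\<lambda>j. if j = i then 1 else 0) x = x $ i"
  by (simp add: monomial_fun_def if_distrib [of "\<lambda>k. _ ^ k"] prod.delta cong: if_cong)

lemma polynomial_of_degree_le_nth: "polynomial_of_degree_le 1 (\<lambda>x. x $ i)"
  using polynomial_of_degree_le_monomial [of "\<lambda>j. if j = i then 1 else 0" 1]
  by (simp add: monomial_fun_unit [abs_def] sum.delta)

lemma polynomial_of_degree_le_nth_diff: "polynomial_of_degree_le 1 (\<lambda>x. (x - y) $ i)"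
  using polynomial_of_degree_le_add [OF polynomial_of_degree_le_nth [of i]
      polynomial_of_degree_le_const [of 1 "- (y $ i)"]]
  by simp

lemma real_polynomial_function_nth: "real_polynomial_function (\<lambda>x :: real ^ 'n::finite. x $ i)"
  by (rule real_polynomial_function.intros(1) [OF bounded_linear_vec_nth])

text \<open>Links the two notions of polynomial: coefficients and degree bounds on one side,
  differentiability and the inductive rules of \<open>real_polynomial_function\<close> on the
  other.\<close>

lemma real_polynomial_function_of_degree_le:
  assumes "polynomial_of_degree_le d f"
  shows "real_polynomial_function f"
proof -
  obtain c where "f = (\<lambda>x. \<Sum>a \<in> {a. (\<Sum>i\<in>UNIV. a i) \<le> d}. c a * monomial_fun a x)"
    using assms unfolding polynomial_of_degree_le_def by blast
  then show ?thesis
    unfolding monomial_fun_def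
    by (simp only:) (intro real_polynomial_function_sum finite_multidegree_le
        real_polynomial_function.intros(4) real_polynomial_function.intros(2)
        real_polynomial_function_prod real_polynomial_function_power
        real_polynomial_function_nth finite)
qed

text \<open>On the line, coordinate i becomes the univariate polynomial
  \<open>[:x $ i, v $ i:]\<close> of degree at most 1, so a monomial becomes a product whose degree
  is bounded by its total degree.\<close>

lemma poly_along_line:
  assumes "polynomial_of_degree_le d f"
  obtains q where "degree q \<le> d" "\<And>t. f (x + t *\<^sub>R v) = poly q t"
proof -
  obtain c where c: "\<And>x. f x = (\<Sum>a \<in> {a. (\<Sum>i\<in>UNIV. a i) \<le> d}. c a * monomial_fun a x)"
    using assms unfolding polynomial_of_degree_le_def by blast
  define m where "m a = (\<Prod>i\<in>UNIV. [:x $ i, v $ i:] ^ a i)" for a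
  define q where "q = (\<Sum>a \<in> {a. (\<Sum>i\<in>UNIV. a i) \<le> d}. smult (c a) (m a))"
  have "degree (m a) \<le> (\<Sum>i\<in>UNIV. a i)" for a
  proof -
    have "degree (m a) \<le> (\<Sum>i\<in>UNIV. degree ([:x $ i, v $ i:] ^ a i))"
      unfolding m_def using degree_prod_sum_le [OF finite, of "\<lambda>i. [:x $ i, v $ i:] ^ a i" UNIV] by (simp add: o_def)
    also have "\<dots> \<le> (\<Sum>i\<in>UNIV. a i)"
      by (intro sum_mono order_trans [OF degree_power_le]) simp
    finally show ?thesis .
  qed
  then have "degree q \<le> d"
    unfolding q_def
    by (intro degree_sum_le finite_multidegree_le order_trans [OF degree_smult_le])
       (metis mem_Collect_eq order_trans)
  moreover have "f (x + t *\<^sub>R v) = poly q t" for t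
    unfolding c q_def m_def monomial_fun_def
    by (simp add: poly_sum poly_prod)
  ultimately show thesis using that by blast
qed

section \<open>Partial derivatives\<close>

text \<open>\<open>deriv\<close> is a choice operator and says nothing unless a derivative exists; a
  total derivative supplies one and identifies its value.\<close>

lemma partial_derivative_eq:
  assumes "(f has_derivative f') (at x)"
  shows "partial_derivative i f x = f' (axis i 1)"
proof -
  have "((\<lambda>t. f (x + t *\<^sub>R axis i 1)) has_derivative (\<lambda>t. f' (t *\<^sub>R axis i 1))) (at 0)"
    by (rule has_derivative_compose [where g = f]) (auto intro!: derivative_eq_intros assms)
  moreover have "f' (t *\<^sub>R axis i 1) = t * f' (axis i 1)" for t
    using linear_scale [OF has_derivative_linear [OF assms]] by simp
  ultimately show ?thesis
    unfolding partial_derivative_def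
    by (intro DERIV_imp_deriv) (simp add: has_field_derivative_def mult_commute_abs)
qed

text \<open>The chain rule, with the direction \<open>v\<close> expanded in the standard basis.
  Writing the result through \<open>partial_derivative\<close> allows the rule to be applied a
  second time.\<close>

lemma DERIV_along_line:
  assumes "f differentiable (at (x + t *\<^sub>R v))"
  shows "((\<lambda>t. f (x + t *\<^sub>R v)) has_real_derivative
      (\<Sum>i\<in>UNIV. v $ i * partial_derivative i f (x + t *\<^sub>R v))) (at t)"
proof -
  obtain f' where f': "(f has_derivative f') (at (x + t *\<^sub>R v))"
    using assms unfolding differentiable_def by blast
  have lin: "linear f'" by (rule has_derivative_linear [OF f'])
  have "((\<lambda>t. f (x + t *\<^sub>R v)) has_derivative (\<lambda>s. f' (s *\<^sub>R v))) (at t)"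
    by (rule has_derivative_compose [where g = f]) (auto intro!: derivative_eq_intros f')
  moreover have "f' v = (\<Sum>i\<in>UNIV. v $ i * f' (axis i 1))"
  proof -
    have "v = (\<Sum>i\<in>UNIV. v $ i *\<^sub>R axis i 1)"
      using basis_expansion [of v] by (simp add: scalar_mult_eq_scaleR)
    then have "f' v = f' (\<Sum>i\<in>UNIV. v $ i *\<^sub>R axis i 1)" by simp
    then show ?thesis by (simp add: linear_sum [OF lin] linear_scale [OF lin])
  qed
  ultimately show ?thesis
    by (simp add: has_field_derivative_def linear_scale [OF lin] partial_derivative_eq [OF f']
        mult_commute_abs)
qed

text \<open>The entries of \<open>hessian\<close> iterate \<open>partial_derivative\<close>, so
  first partial derivatives must again be differentiable. Induction on the construction of
  \<open>f\<close>, by the sum and product rules.\<close>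

lemma real_polynomial_function_partial_derivative:
  assumes "real_polynomial_function f"
  shows "real_polynomial_function (partial_derivative i f)"
  using assms
proof (induction f rule: real_polynomial_function.induct)
  case (linear f)
  then have "partial_derivative i f = (\<lambda>x. f (axis i 1))"
    by (intro ext partial_derivative_eq bounded_linear_imp_has_derivative)
  then show ?case by (simp add: real_polynomial_function.intros(2))
next
  case (const c)
  have "partial_derivative i (\<lambda>x. c) = (\<lambda>x. 0)"
    by (intro ext partial_derivative_eq [where f' = "\<lambda>_. 0"]) simp
  then show ?case by (simp add: real_polynomial_function.intros(2))
next
  case (add f g)
  have "partial_derivative i (\<lambda>x. f x + g x) =
      (\<lambda>x. partial_derivative i f x + partial_derivative i g x)"
  proof
    fix x
    obtain f' g' where d: "(f has_derivative f') (at x)" "(g has_derivative g') (at x)"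
      using add.hyps [THEN differentiable_at_real_polynomial_function, of x UNIV]
      unfolding differentiable_def by blast
    show "partial_derivative i (\<lambda>x. f x + g x) x =
        partial_derivative i f x + partial_derivative i g x"
      using partial_derivative_eq [OF has_derivative_add [OF d]]
      by (simp add: partial_derivative_eq [OF d(1)] partial_derivative_eq [OF d(2)])
  qed
  then show ?case using add.IH by (simp add: real_polynomial_function.intros(3))
next
  case (mult f g)
  have "partial_derivative i (\<lambda>x. f x * g x) =
      (\<lambda>x. f x * partial_derivative i g x + partial_derivative i f x * g x)"
  proof
    fix x
    obtain f' g' where d: "(f has_derivative f') (at x)" "(g has_derivative g') (at x)"
      using mult.hyps [THEN differentiable_at_real_polynomial_function, of x UNIV]
      unfolding differentiable_def by blast
    show "partial_derivative i (\<lambda>x. f x * g x) x =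
        f x * partial_derivative i g x + partial_derivative i f x * g x"
      using partial_derivative_eq [OF has_derivative_mult [OF d]]
      by (simp add: partial_derivative_eq [OF d(1)] partial_derivative_eq [OF d(2)])
  qed
  then show ?case
    using mult by (simp add: real_polynomial_function.intros(3) real_polynomial_function.intros(4))
qed

section \<open>Second derivatives along lines and the expansion of a cubic\<close>

lemma inner_matrix_vector:
  fixes A :: "real ^ 'n::finite ^ 'n"
  shows "v \<bullet> (A *v v) = (\<Sum>i\<in>UNIV. \<Sum>j\<in>UNIV. v $ i * v $ j * A $ i $ j)"
  by (simp add: inner_vec_def matrix_vector_mult_def sum_distrib_left mult_ac)

lemma DERIV_DERIV_along_line:
  assumes "real_polynomial_function f"
  shows "((\<lambda>t. \<Sum>i\<in>UNIV. v $ i * partial_derivative i f (x + t *\<^sub>R v)) has_real_derivative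
      v \<bullet> (hessian f (x + t *\<^sub>R v) *v v)) (at t)"
proof -
  have "((\<lambda>t. \<Sum>i\<in>UNIV. v $ i * partial_derivative i f (x + t *\<^sub>R v)) has_real_derivative
      (\<Sum>i\<in>UNIV. v $ i * (\<Sum>j\<in>UNIV. v $ j *
        partial_derivative j (partial_derivative i f) (x + t *\<^sub>R v)))) (at t)"
    by (intro DERIV_sum DERIV_cmult DERIV_along_line differentiable_at_real_polynomial_function
          real_polynomial_function_partial_derivative assms)
  moreover have "v \<bullet> (hessian f (x + t *\<^sub>R v) *v v) = (\<Sum>i\<in>UNIV. v $ i * (\<Sum>j\<in>UNIV. v $ j *
        partial_derivative j (partial_derivative i f) (x + t *\<^sub>R v)))"
    unfolding inner_matrix_vector hessian_def
    \<comment> \<open>Entry (i, j) of \<open>hessian\<close> differentiates in j first and in i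
      second, the reverse of the order above; exchanging the two sums matches them.\<close>
    by (subst sum.swap) (simp add: sum_distrib_left mult_ac)
  ultimately show ?thesis by simp
qed

text \<open>For g(t) = a + c t^2 + d t^3 one has g''(0) = 2c and g''(1) = 2c + 6d, and 1/3 and 1/6
  are the only weights that combine these to g(1) - g(0) = c + d for all c and d. The vanishing
  gradient removes the linear term.\<close>

lemma cubic_expansion:
  assumes "polynomial_of_degree_le 3 p" and "GDERIV p x :> 0"
  shows "p y - p x =
    1/3 * ((y - x) \<bullet> (hessian p x *v (y - x))) + 1/6 * ((y - x) \<bullet> (hessian p y *v (y - x)))"
proof -
  define v where "v = y - x"
  have rpf: "real_polynomial_function p"
    using assms(1) by (rule real_polynomial_function_of_degree_le)
  obtain q where deg: "degree q \<le> 3" and q: "\<And>t. p (x + t *\<^sub>R v) = poly q t"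
    using poly_along_line [OF assms(1)] by blast
  \<comment> \<open>Both sides are derivatives at \<open>t\<close> of the same function, hence
    equal; \<open>q2\<close> repeats this one order higher.\<close>
  have q1: "(\<Sum>i\<in>UNIV. v $ i * partial_derivative i p (x + t *\<^sub>R v)) = poly (pderiv q) t" for t
    using DERIV_along_line [OF differentiable_at_real_polynomial_function [OF rpf], where x = x and t = t and v = v]
    unfolding q by (rule DERIV_unique [OF _ poly_DERIV])
  have q2: "v \<bullet> (hessian p (x + t *\<^sub>R v) *v v) = poly (pderiv (pderiv q)) t" for t
    using DERIV_DERIV_along_line [OF rpf, where x = x and t = t and v = v]
    unfolding q1 by (rule DERIV_unique [OF _ poly_DERIV])
  have "partial_derivative i p x = 0" for i
    using assms(2) by (simp add: partial_derivative_eq gderiv_def)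
  then have "poly (pderiv q) 0 = 0"
    using q1 [of 0] by simp
  moreover obtain a b c d where "q = [:a, b, c, d:]"
  proof
    show "q = [:coeff q 0, coeff q 1, coeff q 2, coeff q 3:]"
      using deg by (intro poly_eqI) (auto simp: coeff_pCons numeral_eq_Suc coeff_eq_0 split: nat.split)
  qed
  ultimately have "poly q 1 - poly q 0 =
      1/3 * poly (pderiv (pderiv q)) 0 + 1/6 * poly (pderiv (pderiv q)) 1"
    by (simp add: pderiv_pCons field_simps)
  then show ?thesis
    using q [of 0] q [of 1] q2 [of 0] q2 [of 1] by (simp add: v_def)
qed

section \<open>Positive semidefinite forms as sums of squares\<close>

text \<open>Moving from \<open>b\<close> by a small negative multiple of \<open>f b\<close> would
  make the form negative: it equals 2tN + t^2 M at b + t f(b), and the linear term dominates near t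
  = 0.\<close>

lemma self_adjoint_psd_kernel:
  fixes f :: "'a::real_inner \<Rightarrow> 'a"
  assumes "linear f" and sym: "\<And>x y. f x \<bullet> y = x \<bullet> f y" and psd: "\<And>x. 0 \<le> x \<bullet> f x"
    and "b \<bullet> f b = 0"
  shows "f b = 0"
proof (rule ccontr)
  assume "f b \<noteq> 0"
  define N where "N = f b \<bullet> f b"
  define M where "M = f b \<bullet> f (f b)"
  have N: "N > 0" using \<open>f b \<noteq> 0\<close> by (simp add: N_def)
  have M: "M \<ge> 0" using psd by (simp add: M_def)
  \<comment> \<open>The minimiser is -N/M, but M may be 0; the denominator M + 1 is positive and
    still gives a negative value.\<close>
  define t where "t = - (N / (M + 1))"
  have "0 \<le> (b + t *\<^sub>R f b) \<bullet> f (b + t *\<^sub>R f b)" by (rule psd)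
  also have "\<dots> = 2 * t * N + t\<^sup>2 * M"
    using assms(4) sym [of b "f b"]
    by (simp add: linear_add [OF assms(1)] linear_scale [OF assms(1)] inner_add_left
        inner_add_right N_def M_def power2_eq_square algebra_simps)
  also have "\<dots> = - (N\<^sup>2 * (M + 2) / (M + 1)\<^sup>2)"
    using M by (simp add: t_def divide_simps) (simp add: power2_eq_square algebra_simps)
  also have "\<dots> < 0" using N M by simp
  finally show False by simp
qed

text \<open>Lagrange's elimination. For a basis vector \<open>b\<close> with f(b) nonzero, the
  kernel lemma gives s = b . f(b) > 0. Subtracting the square (b . f(x))^2 / s leaves a positive
  semidefinite form whose operator \<open>g\<close> kills \<open>b\<close> and everything that
  \<open>f\<close> kills, so the number of surviving basis vectors drops.\<close>

lemma self_adjoint_psd_sum_of_squares: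
  fixes f :: "'a::euclidean_space \<Rightarrow> 'a"
  assumes "linear f" "\<And>x y. f x \<bullet> y = x \<bullet> f y" "\<And>x. 0 \<le> x \<bullet> f x"
  shows "\<exists>(r::nat) u. \<forall>x. x \<bullet> f x = (\<Sum>k<r. (u k \<bullet> x)\<^sup>2)"
  using assms
proof (induction "card {b \<in> Basis. f b \<noteq> 0}" arbitrary: f rule: less_induct)
  case less
  note lin = less.prems(1) and sym = less.prems(2) and psd = less.prems(3)
  show ?case
  proof (cases "\<exists>b\<in>Basis. f b \<noteq> 0")
    case False
    then have "f x = 0" for x
      using linear_eq_on_span [of f "\<lambda>_. 0" Basis x] lin by (simp add: linear_zero)
    then show ?thesis by (intro exI [of _ 0]) simp
  next
    case True
    then obtain b where b: "b \<in> Basis" "f b \<noteq> 0" by blast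
    define s where "s = b \<bullet> f b"
    have s: "s > 0"
      using self_adjoint_psd_kernel [OF lin sym psd, of b] b psd [of b]
      by (force simp: s_def)
    define g where "g x = f x - (b \<bullet> f x / s) *\<^sub>R f b" for x
    have g_form: "x \<bullet> g x = x \<bullet> f x - (b \<bullet> f x)\<^sup>2 / s" for x
      using sym [of x b] by (simp add: g_def inner_diff_right power2_eq_square inner_commute)
    have "linear g"
      by (rule linearI)
        (simp_all add: g_def linear_add [OF lin] linear_scale [OF lin] inner_add_right
          add_divide_distrib algebra_simps)
    moreover have "g x \<bullet> y = x \<bullet> g y" for x y
      using sym [of x y] sym [of b x] sym [of b y]
      by (simp add: g_def inner_diff_left inner_diff_right inner_commute)
    moreover have "0 \<le> x \<bullet> g x" for x
    proof -
      \<comment> \<open>This \<open>c\<close> minimises the form of \<open>f\<close> at x - c b; the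
        minimum, found by completing the square, is the form of \<open>g\<close> at
        \<open>x\<close>.\<close>
      define c where "c = b \<bullet> f x / s"
      have "0 \<le> (x - c *\<^sub>R b) \<bullet> f (x - c *\<^sub>R b)" by (rule psd)
      also have "\<dots> = x \<bullet> f x - 2 * c * (b \<bullet> f x) + c\<^sup>2 * s"
        using sym [of x b]
        by (simp add: linear_diff [OF lin] linear_scale [OF lin] inner_diff_left inner_diff_right
            s_def power2_eq_square inner_commute algebra_simps)
      also have "\<dots> = x \<bullet> g x"
        unfolding g_form using s by (simp add: c_def field_simps power2_eq_square)
      finally show ?thesis .
    qed
    moreover have "card {b \<in> Basis. g b \<noteq> 0} < card {b \<in> Basis. f b \<noteq> 0}"
    proof (rule psubset_card_mono)
      have "g b = 0" using s by (simp add: g_def s_def)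
      moreover have "g c = 0" if "f c = 0" for c using that by (simp add: g_def)
      ultimately show "{b \<in> Basis. g b \<noteq> 0} \<subset> {b \<in> Basis. f b \<noteq> 0}"
        using b by blast
    qed simp
    ultimately obtain r :: nat and u where u: "\<And>x. x \<bullet> g x = (\<Sum>k<r. (u k \<bullet> x)\<^sup>2)"
      using less.hyps [of g] by blast
    \<comment> \<open>The eliminated square becomes summand number \<open>r\<close>: by
      self-adjointness f(b) . x = b . f(x), and the factor 1 / sqrt s supplies the division by
      \<open>s\<close>.\<close>
    define u' where "u' = u(r := (1 / sqrt s) *\<^sub>R f b)"
    have "x \<bullet> f x = (\<Sum>k<Suc r. (u' k \<bullet> x)\<^sup>2)" for x
    proof -
      have "(u' r \<bullet> x)\<^sup>2 = (b \<bullet> f x)\<^sup>2 / s"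
        using s sym [of b x] by (simp add: u'_def power_divide)
      then show ?thesis
        using u [of x] by (simp add: g_form u'_def)
    qed
    then show ?thesis by blast
  qed
qed

lemma positive_semidefinite_sum_of_squares:
  assumes "positive_semidefinite A"
  obtains r :: nat and u where "\<And>x. x \<bullet> (A *v x) = (\<Sum>k<r. (u k \<bullet> x)\<^sup>2)"
proof -
  have "(A *v x) \<bullet> y = x \<bullet> (A *v y)" for x y
    using assms dot_lmul_matrix [of x A y] transpose_matrix_vector [of A x]
    by (simp add: positive_semidefinite_def)
  then show thesis
    using self_adjoint_psd_sum_of_squares [of "(*v) A"] assms that
    by (auto simp: positive_semidefinite_def)
qed

section \<open>The semidefinite program\<close>

lemma sdp_feasible_le:
  assumes "(\<gamma>, \<sigma>, S) \<in> sdp_feasible p" and "second_order_point p x"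
  shows "\<gamma> \<le> p x"
proof -
  have eq: "p x - \<gamma> = \<sigma> x + trace (S x ** hessian p x)" and "sos \<sigma>" "sos_matrix S"
    using assms(1) by (auto simp: sdp_feasible_def)
  have psd: "0 \<le> v \<bullet> (hessian p x *v v)" for v
    using assms(2) by (simp add: second_order_point_def positive_semidefinite_def)
  have "0 \<le> \<sigma> x"
    using \<open>sos \<sigma>\<close> by (auto simp: sos_def intro!: sum_nonneg)
  moreover have "0 \<le> trace (S x ** hessian p x)"
  proof -
    obtain r :: nat and R where R: "\<And>i j. S x $ i $ j = (\<Sum>k<r. R k i x * R k j x)"
      using \<open>sos_matrix S\<close> unfolding sos_matrix_def by blast
    \<comment> \<open>Writing S = R^T R, the trace is the sum over the rows r_k of R of r_k^T H r_k,
      each nonnegative. The exchanges below move the sum over \<open>k\<close> outside.\<close>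
    have "trace (S x ** hessian p x) =
        (\<Sum>i\<in>UNIV. \<Sum>j\<in>UNIV. \<Sum>k<r. R k j x * R k i x * hessian p x $ j $ i)"
      by (simp add: trace_def matrix_matrix_mult_def R sum_distrib_right)
         (simp add: mult_ac)
    also have "\<dots> = (\<Sum>j\<in>UNIV. \<Sum>i\<in>UNIV. \<Sum>k<r. R k j x * R k i x * hessian p x $ j $ i)"
      by (rule sum.swap)
    also have "\<dots> = (\<Sum>j\<in>UNIV. \<Sum>k<r. \<Sum>i\<in>UNIV. R k j x * R k i x * hessian p x $ j $ i)"
      by (intro sum.cong refl sum.swap)
    also have "\<dots> = (\<Sum>k<r. \<Sum>j\<in>UNIV. \<Sum>i\<in>UNIV. R k j x * R k i x * hessian p x $ j $ i)"
      by (rule sum.swap)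
    also have "\<dots> = (\<Sum>k<r. (\<chi> i. R k i x) \<bullet> (hessian p x *v (\<chi> i. R k i x)))"
      by (simp add: inner_matrix_vector)
    also have "0 \<le> \<dots>" by (intro sum_nonneg psd)
    finally show ?thesis .
  qed
  ultimately show ?thesis using eq by linarith
qed

text \<open>The certificate is read off from \<open>cubic_expansion\<close>: the Hessian at the
  fixed point \<open>x\<close> gives the quadratic form \<sigma>, while the Hessian at the variable
  \<open>y\<close> is paired with a rank-one matrix.\<close>

lemma sdp_feasible_at_second_order_point:
  assumes "polynomial_of_degree_le 3 p" and "second_order_point p x"
  shows "(p x, \<lambda>y. 1/3 * ((y - x) \<bullet> (hessian p x *v (y - x))),
      \<lambda>y. \<chi> i j. 1/6 * ((y - x) $ i * (y - x) $ j)) \<in> sdp_feasible p"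
    (is "(_, ?\<sigma>, ?S) \<in> _")
proof -
  have "GDERIV p x :> 0" and psd: "positive_semidefinite (hessian p x)"
    using assms(2) by (auto simp: second_order_point_def)
  then have "p y - p x = ?\<sigma> y + trace (?S y ** hessian p y)" for y
  proof -
    have "trace (?S y ** hessian p y) =
        (\<Sum>i\<in>UNIV. \<Sum>j\<in>UNIV. 1/6 * ((y - x) $ j * (y - x) $ i * hessian p y $ j $ i))"
      by (simp add: trace_def matrix_matrix_mult_def mult_ac)
    also have "\<dots> =
        (\<Sum>j\<in>UNIV. \<Sum>i\<in>UNIV. 1/6 * ((y - x) $ j * (y - x) $ i * hessian p y $ j $ i))"
      by (rule sum.swap)
    also have "\<dots> = 1/6 * ((y - x) \<bullet> (hessian p y *v (y - x)))"
      by (simp only: inner_matrix_vector sum_distrib_left)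
    finally show ?thesis
      using cubic_expansion [OF assms(1) \<open>GDERIV p x :> 0\<close>, of y] by linarith
  qed
  moreover have deg2: "polynomial_of_degree_le 2 (\<lambda>y. (y - x) $ i * (y - x) $ j)" for i j
    using polynomial_of_degree_le_mult [OF polynomial_of_degree_le_nth_diff [of x i]
        polynomial_of_degree_le_nth_diff [of x j]]
    by (simp add: numeral_2_eq_2)
  \<comment> \<open>The entries of \<open>hessian p x\<close> are constants here, as the polynomial
    variable is \<open>y\<close>.\<close>
  have "polynomial_of_degree_le 2 (\<lambda>y. 1/3 * (\<Sum>i\<in>UNIV. \<Sum>j\<in>UNIV.
      hessian p x $ i $ j * ((y - x) $ i * (y - x) $ j)))"
    by (intro polynomial_of_degree_le_cmult polynomial_of_degree_le_sum deg2)
  then have "polynomial_of_degree_le 2 ?\<sigma>"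
    by (simp only: inner_matrix_vector mult.commute mult.left_commute)
  moreover have "sos ?\<sigma>"
  proof -
    obtain r :: nat and u
      where u: "\<And>v. v \<bullet> (hessian p x *v v) = (\<Sum>k<r. (u k \<bullet> v)\<^sup>2)"
      using positive_semidefinite_sum_of_squares [OF psd] by blast
    \<comment> \<open>The weight 1/3 is absorbed into the squared linear forms.\<close>
    have "real_polynomial_function (\<lambda>y. sqrt (1/3) * (u k \<bullet> (y - x)))" for k
      unfolding inner_diff_right
      by (rule real_polynomial_function.intros(4) [OF real_polynomial_function.intros(2)
            real_polynomial_function_diff [OF
              real_polynomial_function.intros(1) [OF bounded_linear_inner_right]
              real_polynomial_function.intros(2)]])
    moreover have "?\<sigma> y = (\<Sum>k<r. (sqrt (1/3) * (u k \<bullet> (y - x)))\<^sup>2)" for y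
      unfolding u by (simp only: power_mult_distrib sum_distrib_left) simp
    ultimately show ?thesis
      unfolding sos_def
      by (intro exI [of _ r] exI [of _ "\<lambda>k y. sqrt (1/3) * (u k \<bullet> (y - x))"]) blast
  qed
  moreover have entries: "polynomial_of_degree_le 2 (\<lambda>y. ?S y $ i $ j)" for i j
    using polynomial_of_degree_le_cmult [OF deg2, of "1/6" i j] by simp
  moreover have "sos_matrix ?S"
    unfolding sos_matrix_def
  proof (intro conjI allI)
    show "real_polynomial_function (\<lambda>y. ?S y $ i $ j)" for i j
      using entries by (rule real_polynomial_function_of_degree_le)
    show "transpose (?S y) = ?S y" for y
      by (simp add: transpose_def vec_eq_iff mult.commute)
    \<comment> \<open>The factor R has a single row, sqrt(1/6) (y - x)^T, hence \<open>Suc 0\<close>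
      as the number of rows.\<close>
    have "real_polynomial_function (\<lambda>y. sqrt (1/6) * (y - x) $ i)" for i
      by (rule real_polynomial_function_of_degree_le
          [OF polynomial_of_degree_le_cmult [OF polynomial_of_degree_le_nth_diff]])
    moreover have "?S y $ i $ j =
        (\<Sum>k<Suc 0. (sqrt (1/6) * (y - x) $ i) * (sqrt (1/6) * (y - x) $ j))" for y i j
    proof -
      have "sqrt (1/6) * sqrt (1/6) = (1/6 :: real)" by simp
      then have "(sqrt (1/6) * a) * (sqrt (1/6) * b) = 1/6 * (a * b)" for a b :: real
        by (metis mult.assoc mult.left_commute)
      then show ?thesis by (simp only: lessThan_Suc lessThan_0) simp
    qed
    ultimately show "\<exists>(r::nat) R. (\<forall>k<r. \<forall>i. real_polynomial_function (R k i)) \<and>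
        (\<forall>y i j. ?S y $ i $ j = (\<Sum>k<r. R k i y * R k j y))"
      by (intro exI [of _ "Suc 0"] exI [of _ "\<lambda>k i y. sqrt (1/6) * (y - x) $ i"]) blast
  qed
  ultimately show ?thesis
    unfolding sdp_feasible_def by blast
qed

theorem theorem6p2:
  fixes p :: "real ^ 'n::finite \<Rightarrow> real"
  assumes "polynomial_of_degree_le 3 p"
    and "\<exists>x. second_order_point p x"
  shows "(\<exists>(\<gamma>, \<sigma>, S) \<in> sdp_feasible p. ereal \<gamma> = sdp_value p) \<and>
         (\<forall>x. second_order_point p x \<longrightarrow> sdp_value p = ereal (p x))"
proof -
  \<comment> \<open>Proved for an arbitrary second-order point; as \<open>sdp_value p\<close> does
    not depend on \<open>x\<close>, all of them share one value of \<open>p\<close>.\<close>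
  have val: "sdp_value p = ereal (p x)" if x: "second_order_point p x" for x
    unfolding sdp_value_def
  proof (rule antisym)
    show "(SUP (\<gamma>, \<sigma>, S) \<in> sdp_feasible p. ereal \<gamma>) \<le> ereal (p x)"
      using sdp_feasible_le [OF _ x] by (auto intro!: SUP_least)
    show "ereal (p x) \<le> (SUP (\<gamma>, \<sigma>, S) \<in> sdp_feasible p. ereal \<gamma>)"
      by (rule SUP_upper2 [OF sdp_feasible_at_second_order_point [OF assms(1) x]]) simp
  qed
  obtain x where x: "second_order_point p x"
    using assms(2) by blast
  \<comment> \<open>Attainment: the explicit certificate at any one second-order point is already
    optimal.\<close>
  have "\<exists>(\<gamma>, \<sigma>, S) \<in> sdp_feasible p. ereal \<gamma> = sdp_value p"
    by (rule bexI [OF _ sdp_feasible_at_second_order_point [OF assms(1) x]]) (simp add: val [OF x])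
  then show ?thesis using val by blast
qed

end
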